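(* Let $(\mathbf x^*,\mathbf r^* )$ be an optimal solution of the fluid utility maximization problem $$\max_{\mathbf x,\mathbf r}\ \sum_{s,d}U_{sd}(x_s^d)$$ subject to (i) $x_s^d\ge0$ for all $s,d\in\mathcal N$; (ii) $r_{ij}^d\ge0$ for all $(i,j)\in\mathcal L$ and all $d$; (iii) $\sum_dr_{ij}^d+\sum_dr_{ji}^d\le c_{ij}$ for all $(i,j)\in\mathcal L$; (iv) $x_i^d+\sum_{\langle m,i\rangle\in\mathcal L}r_{mi}^d\le\sum_{\langle i,j\rangle\in\mathcal L}r_{ij}^d$ for all $i\in\mathcal N$, $d\in\mathcal D$, $i\ne d$. Define $\hat{\mathbf x}^*=\mathbf x^*$ and, for every $(i,j)\in\mathcal L$ and every $d$, $$\hat r_{ij}^{*d}=(r_{ij}^{*d}-r_{ji}^{*d})^+,\qquad \hat r_{ji}^{*d}=(r_{ji}^{*d}-r_{ij}^{*d})^+ .$$ Then $(\hat{\mathbf x}^*,\hat{\mathbf r}^* )$ is also an optimal solution of the same problem.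
   Context: $\mathcal G=(\mathcal N,\mathcal L,\mathbf c)$ is a network: $\mathcal N$ is a finite set of nodes, $\mathcal L$ a set of bidirectional links $(i,j)$, and $c_{ij}=c_{ji}$ is the capacity of $(i,j)$, shared by its two directions; $\mathbf c=(c_{ij})$. $\langle i,j\rangle$ denotes the directed link from $i$ to $j$; both $\langle i,j\rangle$ and $\langle j,i\rangle$ are available whenever $(i,j)\in\mathcal L$. $\mathcal D\subseteq\mathcal N$ is the set of destinations; commodities are identified with their destinations $d\in\mathcal D$. $x_s^d$ is the exogenous arrival rate at node $s$ of packets destined to $d$, $\mathbf x=(x_s^d)_{s,d}$, and $r_{ij}^d$ is the rate of commodity $d$ on $\langle i,j\rangle$, $\mathbf r=(r_{ij}^d)_{i,j,d}$. The objective sums over source-destination pairs $(s,d)$, each with a utility function $U_{sd}$ that is strictly concave, twice differentiable and increasing. $(Z)^+=\max(0,Z)$. *)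

theory Defs
  imports "HOL-Analysis.Analysis"
begin

(* A bidirectional link is represented by both of its orientations: the directed link from i to j
   is available iff (i, j) is in L. Only the values of c on L are meaningful. *)
definition network :: "'a set \<Rightarrow> ('a \<times> 'a) set \<Rightarrow> ('a \<Rightarrow> 'a \<Rightarrow> real) \<Rightarrow> 'a set \<Rightarrow> bool" where
  "network N L c D \<longleftrightarrow>
     finite N \<and> L \<subseteq> N \<times> N \<and> sym L \<and> (\<forall>(i, j) \<in> L. c i j = c j i) \<and> D \<subseteq> N"

definition strictly_concave_on :: "real set \<Rightarrow> (real \<Rightarrow> real) \<Rightarrow> bool" where
  "strictly_concave_on S f \<longleftrightarrow> convex S \<and>
     (\<forall>x\<in>S. \<forall>y\<in>S. \<forall>t. x \<noteq> y \<longrightarrow> 0 < t \<longrightarrow> t < 1 \<longrightarrow>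
        (1 - t) * f x + t * f y < f ((1 - t) * x + t * y))"

(* Rates are nonnegative, so utilities live on the half-line {0..}. Differentiability is required
   only in its interior; at 0 no one-sided derivative is demanded, which admits e.g. sqrt. *)
definition utility :: "(real \<Rightarrow> real) \<Rightarrow> bool" where
  "utility u \<longleftrightarrow> strictly_concave_on {0..} u \<and> mono_on {0..} u \<and>
     u differentiable_on {0<..} \<and> deriv u differentiable_on {0<..}"

(* x s d is the arrival rate at s of packets destined to d;
   r i j d is the rate of commodity d on the directed link from i to j. *)
definition feasible ::
  "'a set \<Rightarrow> ('a \<times> 'a) set \<Rightarrow> ('a \<Rightarrow> 'a \<Rightarrow> real) \<Rightarrow> 'a set \<Rightarrow>
   ('a \<Rightarrow> 'a \<Rightarrow> real) \<Rightarrow> ('a \<Rightarrow> 'a \<Rightarrow> 'a \<Rightarrow> real) \<Rightarrow> bool" where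
  "feasible N L c D x r \<longleftrightarrow>
     (\<forall>s\<in>N. \<forall>d\<in>N. 0 \<le> x s d) \<and>
     (\<forall>(i, j)\<in>L. \<forall>d\<in>D. 0 \<le> r i j d) \<and>
     (\<forall>(i, j)\<in>L. (\<Sum>d\<in>D. r i j d) + (\<Sum>d\<in>D. r j i d) \<le> c i j) \<and>
     (\<forall>i\<in>N. \<forall>d\<in>D. i \<noteq> d \<longrightarrow>
        x i d + (\<Sum>m | (m, i) \<in> L. r m i d) \<le> (\<Sum>j | (i, j) \<in> L. r i j d))"

(* P is the set of source-destination pairs that carry a utility. *)
definition total_utility ::
  "('a \<times> 'a) set \<Rightarrow> ('a \<Rightarrow> 'a \<Rightarrow> real \<Rightarrow> real) \<Rightarrow> ('a \<Rightarrow> 'a \<Rightarrow> real) \<Rightarrow> real" where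
  "total_utility P U x = (\<Sum>(s, d)\<in>P. U s d (x s d))"

definition optimal_solution ::
  "'a set \<Rightarrow> ('a \<times> 'a) set \<Rightarrow> ('a \<Rightarrow> 'a \<Rightarrow> real) \<Rightarrow> 'a set \<Rightarrow>
   ('a \<times> 'a) set \<Rightarrow> ('a \<Rightarrow> 'a \<Rightarrow> real \<Rightarrow> real) \<Rightarrow>
   ('a \<Rightarrow> 'a \<Rightarrow> real) \<Rightarrow> ('a \<Rightarrow> 'a \<Rightarrow> 'a \<Rightarrow> real) \<Rightarrow> bool" where
  "optimal_solution N L c D P U x r \<longleftrightarrow>
     feasible N L c D x r \<and>
     (\<forall>x' r'. feasible N L c D x' r' \<longrightarrow> total_utility P U x' \<le> total_utility P U x)"

end

theory Submission
  imports Defs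
begin

text \<open>
  On each link, subtract the common amount \<open>min (r i j d) (r j i d)\<close> from the two opposite rates of
  each commodity. What remains is the pair of positive parts of the difference, so the construction
  cancels circulating flow. Flow conservation at a node sees only the net rates
  \<open>r i j d - r j i d\<close>, because every neighbour of the node is joined to it in both directions, and
  the net rates do not change (lemma \<open>conservation_iff_net_rate\<close>). The load of a link can only drop,
  from \<open>r i j d + r j i d\<close> to the absolute value of the net rate. Hence the cancelled rates support
  the same arrival rates (lemma \<open>feasible_cancel_opposite_rates\<close>). Since the objective depends on
  the arrival rates alone, optimality carries over.
\<close>

text \<open>
  Symmetry of the links makes the predecessors and the successors of \<open>i\<close> the same set, so the
  incoming and outgoing sums can be paired term by term.
\<close>

lemma conservation_iff_net_rate:
  fixes f :: "'a \<Rightarrow> 'a \<Rightarrow> real" and a :: real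
  assumes "sym L"
  shows "a + (\<Sum>m | (m, i) \<in> L. f m i) \<le> (\<Sum>j | (i, j) \<in> L. f i j) \<longleftrightarrow>
         a \<le> (\<Sum>j | (i, j) \<in> L. f i j - f j i)"
proof -
  have "{m. (m, i) \<in> L} = {j. (i, j) \<in> L}"
    using assms by (auto dest: symD)
  then show ?thesis
    by (simp add: sum_subtractf algebra_simps)
qed

lemma feasible_cancel_opposite_rates:
  assumes L: "sym L"
    and feas: "feasible N L c D x r"
    and rhat: "\<And>i j d. (i, j) \<in> L \<Longrightarrow> d \<in> D \<Longrightarrow> rhat i j d = max 0 (r i j d - r j i d)"
  shows "feasible N L c D x rhat"
proof -
  have rev: "(j, i) \<in> L" if "(i, j) \<in> L" for i j
    using L that by (rule symD)
  have "0 \<le> rhat i j d" if "(i, j) \<in> L" "d \<in> D" for i j d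
    using rhat[OF that] by simp
  moreover have "(\<Sum>d\<in>D. rhat i j d) + (\<Sum>d\<in>D. rhat j i d) \<le> c i j" if ij: "(i, j) \<in> L" for i j
  proof -
    have "rhat i j d + rhat j i d \<le> r i j d + r j i d" if d: "d \<in> D" for d
    proof -
      have "0 \<le> r i j d" "0 \<le> r j i d"
        using feas ij rev[OF ij] d by (auto simp: feasible_def)
      then show ?thesis
        using rhat[OF ij d] rhat[OF rev[OF ij] d] by simp
    qed
    then have "(\<Sum>d\<in>D. rhat i j d + rhat j i d) \<le> (\<Sum>d\<in>D. r i j d + r j i d)"
      by (rule sum_mono)
    also have "\<dots> \<le> c i j"
      using feas ij by (auto simp: feasible_def sum.distrib)
    finally show ?thesis
      by (simp add: sum.distrib)
  qed
  moreover have "x i d + (\<Sum>m | (m, i) \<in> L. rhat m i d) \<le> (\<Sum>j | (i, j) \<in> L. rhat i j d)"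
    if "i \<in> N" "d \<in> D" "i \<noteq> d" for i d
  proof -
    have "rhat i j d - rhat j i d = r i j d - r j i d" if "(i, j) \<in> L" for j
      using rhat[OF that \<open>d \<in> D\<close>] rhat[OF rev[OF that] \<open>d \<in> D\<close>] by simp
    then have "(\<Sum>j | (i, j) \<in> L. rhat i j d - rhat j i d) = (\<Sum>j | (i, j) \<in> L. r i j d - r j i d)"
      by (intro sum.cong) auto
    moreover have "x i d + (\<Sum>m | (m, i) \<in> L. r m i d) \<le> (\<Sum>j | (i, j) \<in> L. r i j d)"
      using feas that by (auto simp: feasible_def)
    ultimately show ?thesis
      using conservation_iff_net_rate[OF L, of "x i d" "\<lambda>i j. r i j d" i]
        conservation_iff_net_rate[OF L, of "x i d" "\<lambda>i j. rhat i j d" i]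
      by simp
  qed
  ultimately show ?thesis
    using feas unfolding feasible_def by auto
qed

theorem proposition1:
  fixes N D :: "'a set" and L P :: "('a \<times> 'a) set" and c :: "'a \<Rightarrow> 'a \<Rightarrow> real"
    and U :: "'a \<Rightarrow> 'a \<Rightarrow> real \<Rightarrow> real"
    and x xhat :: "'a \<Rightarrow> 'a \<Rightarrow> real" and r rhat :: "'a \<Rightarrow> 'a \<Rightarrow> 'a \<Rightarrow> real"
  assumes "network N L c D"
    and "P \<subseteq> N \<times> D"
    and "\<And>s d. (s, d) \<in> P \<Longrightarrow> utility (U s d)"
    and "optimal_solution N L c D P U x r"
    and "xhat = x"
    and "\<And>i j d. (i, j) \<in> L \<Longrightarrow> d \<in> D \<Longrightarrow>
           rhat i j d = max 0 (r i j d - r j i d) \<and> rhat j i d = max 0 (r j i d - r i j d)"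
  shows "optimal_solution N L c D P U xhat rhat"
proof -
  have "sym L"
    using assms(1) by (simp add: network_def)
  moreover have "feasible N L c D x r"
    using assms(4) by (simp add: optimal_solution_def)
  ultimately have "feasible N L c D x rhat"
    by (rule feasible_cancel_opposite_rates) (use assms(6) in blast)
  then show ?thesis
    using assms(4) by (simp add: optimal_solution_def \<open>xhat = x\<close>)
qed

end
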